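(* Let $q=t+ix+jy+kz$ and $q_1$ be commutative quaternions, let $\sigma$ be the Hamilton operator assigning to each commutative quaternion its Hamilton matrix, and let $\lambda\in\mathbb{R}$. Then: (i) $\sigma(qq_1)=\sigma(q)\sigma(q_1)$; (ii) $\sigma(\sigma(q)q_1)=\sigma(q)\sigma(q_1)$, where $\sigma(q)q_1$ denotes the commutative quaternion whose coordinate column vector is the product of the matrix $\sigma(q)$ with the coordinate column vector of $q_1$; (iii) $q=q_1$ if and only if $\sigma(q_1)=\sigma(q)$; (iv) $\sigma(q+q_1)=\sigma(q)+\sigma(q_1)$; (v) $\sigma(\lambda q)=\lambda\sigma(q)$; (vi) $\operatorname{Trace}(\sigma(q))=q+q^{(1)}+q^{(2)}+q^{(3)}=4t$; (vii) $\|q\|^4=|\det(\sigma(q))|=\left|\left[(t+y)^2+(x+z)^2\right]\left[(t-y)^2+(x-z)^2\right]\right|$.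
   Context: The commutative quaternions are the real algebra $H=\{q=t+ix+jy+kz : t,x,y,z\in\mathbb{R}\}$ with $\mathbb{R}$-basis $1,i,j,k$ and commutative bilinear multiplication determined by $i^2=k^2=-1$, $j^2=1$, $ijk=-1$, $ij=ji=k$, $jk=kj=i$, $ki=ik=-j$. For $q=t+ix+jy+kz$ the three principal conjugates are $q^{(1)}=t-ix+jy-kz$, $q^{(2)}=t+ix-jy-kz$, $q^{(3)}=t-ix-jy+kz$. The norm $\|q\|\ge 0$ is defined by $\|q\|^4=|q\,q^{(1)}q^{(2)}q^{(3)}|$ (the product $q\,q^{(1)}q^{(2)}q^{(3)}$ is a real number). The commutative quaternion $t_1+ix_1+jy_1+kz_1$ is identified with its coordinate column vector $(t_1,x_1,y_1,z_1)^T\in\mathbb{R}^4$. The Hamilton matrix $\sigma(q)$ of $q=t+ix+jy+kz$ is the matrix of the linear map $H\to H$, $p\mapsto qp$, in the basis $\{1,i,j,k\}$, that is, $$\sigma(q)=\begin{pmatrix} t&-x&y&-z\\ x&t&z&y\\ y&-z&t&-x\\ z&y&x&t\end{pmatrix}.$$ *)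

theory Defs
  imports "HOL-Analysis.Analysis"
begin

text \<open>The quaternion \<open>CQuat t x y z\<close> is \<open>t + ix + jy + kz\<close>; see \<open>CQuat_basis\<close>.\<close>

datatype cquat = CQuat (cq_t: real) (cq_x: real) (cq_y: real) (cq_z: real)

lemma cquat_eq_iff:
  "p = q \<longleftrightarrow> cq_t p = cq_t q \<and> cq_x p = cq_x q \<and> cq_y p = cq_y q \<and> cq_z p = cq_z q"
  by (cases p; cases q) simp

instantiation cquat :: "{comm_ring_1, real_algebra_1}"
begin

definition zero_cquat :: cquat where
  "0 = CQuat 0 0 0 0"

definition one_cquat :: cquat where
  "1 = CQuat 1 0 0 0"

definition plus_cquat :: "cquat \<Rightarrow> cquat \<Rightarrow> cquat" where
  "p + q = CQuat (cq_t p + cq_t q) (cq_x p + cq_x q) (cq_y p + cq_y q) (cq_z p + cq_z q)"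

definition uminus_cquat :: "cquat \<Rightarrow> cquat" where
  "- p = CQuat (- cq_t p) (- cq_x p) (- cq_y p) (- cq_z p)"

definition minus_cquat :: "cquat \<Rightarrow> cquat \<Rightarrow> cquat" where
  "p - q = CQuat (cq_t p - cq_t q) (cq_x p - cq_x q) (cq_y p - cq_y q) (cq_z p - cq_z q)"

definition scaleR_cquat :: "real \<Rightarrow> cquat \<Rightarrow> cquat" where
  "r *\<^sub>R p = CQuat (r * cq_t p) (r * cq_x p) (r * cq_y p) (r * cq_z p)"

text \<open>The bilinear extension of the multiplication table, which is recovered in
  \<open>cq_mult_table\<close>.\<close>

definition times_cquat :: "cquat \<Rightarrow> cquat \<Rightarrow> cquat" where
  "p * q = CQuat
     (cq_t p * cq_t q - cq_x p * cq_x q + cq_y p * cq_y q - cq_z p * cq_z q)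
     (cq_t p * cq_x q + cq_x p * cq_t q + cq_y p * cq_z q + cq_z p * cq_y q)
     (cq_t p * cq_y q + cq_y p * cq_t q - cq_x p * cq_z q - cq_z p * cq_x q)
     (cq_t p * cq_z q + cq_z p * cq_t q + cq_x p * cq_y q + cq_y p * cq_x q)"

instance
  by standard
    (simp_all add: cquat_eq_iff zero_cquat_def one_cquat_def plus_cquat_def uminus_cquat_def
      minus_cquat_def scaleR_cquat_def times_cquat_def algebra_simps)

end

lemmas cquat_defs = zero_cquat_def one_cquat_def plus_cquat_def uminus_cquat_def
  minus_cquat_def scaleR_cquat_def times_cquat_def

lemma of_real_cquat: "of_real r = CQuat r 0 0 0"
  by (simp add: of_real_def cquat_defs)

definition cq_i :: cquat where "cq_i = CQuat 0 1 0 0"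
definition cq_j :: cquat where "cq_j = CQuat 0 0 1 0"
definition cq_k :: cquat where "cq_k = CQuat 0 0 0 1"

lemma CQuat_basis:
  "CQuat t x y z = of_real t + cq_i * of_real x + cq_j * of_real y + cq_k * of_real z"
  by (simp add: of_real_cquat cquat_defs cq_i_def cq_j_def cq_k_def)

lemma cq_mult_table:
  "cq_i * cq_i = -1" "cq_k * cq_k = -1" "cq_j * cq_j = 1" "cq_i * cq_j * cq_k = -1"
  "cq_i * cq_j = cq_k" "cq_j * cq_i = cq_k"
  "cq_j * cq_k = cq_i" "cq_k * cq_j = cq_i"
  "cq_k * cq_i = - cq_j" "cq_i * cq_k = - cq_j"
  by (simp_all add: cquat_defs cq_i_def cq_j_def cq_k_def)

definition cq_conj1 :: "cquat \<Rightarrow> cquat" where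
  "cq_conj1 q = CQuat (cq_t q) (- cq_x q) (cq_y q) (- cq_z q)"

definition cq_conj2 :: "cquat \<Rightarrow> cquat" where
  "cq_conj2 q = CQuat (cq_t q) (cq_x q) (- cq_y q) (- cq_z q)"

definition cq_conj3 :: "cquat \<Rightarrow> cquat" where
  "cq_conj3 q = CQuat (cq_t q) (- cq_x q) (- cq_y q) (cq_z q)"

text \<open>The product of a quaternion with its three conjugates is real, so its component
  \<open>cq_t\<close> is the whole product; \<open>cq_norm_unique\<close> is the defining property of the norm.
  The library's \<open>norm\<close> is not used because this function vanishes on nonzero zero divisors
  such as \<open>1 + j\<close>.\<close>

definition cq_norm :: "cquat \<Rightarrow> real" where
  "cq_norm q = root 4 \<bar>cq_t (q * cq_conj1 q * cq_conj2 q * cq_conj3 q)\<bar>"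

lemma cq_conj_prod_real:
  "q * cq_conj1 q * cq_conj2 q * cq_conj3 q =
     of_real (cq_t (q * cq_conj1 q * cq_conj2 q * cq_conj3 q))"
  by (simp add: of_real_cquat times_cquat_def cq_conj1_def cq_conj2_def cq_conj3_def algebra_simps)

lemma cq_norm_unique:
  assumes "q * cq_conj1 q * cq_conj2 q * cq_conj3 q = of_real r"
  shows "n = cq_norm q \<longleftrightarrow> 0 \<le> n \<and> n ^ 4 = \<bar>r\<bar>"
proof -
  have "cq_norm q = root 4 \<bar>r\<bar>"
    using assms by (simp add: cq_norm_def of_real_cquat)
  then show ?thesis
    by (auto simp: real_root_pos_unique)
qed

lemma vector_4 [simp]:
  "(vector [a, b, c, d] :: 'a::zero ^ 4) $ 1 = a"
  "(vector [a, b, c, d] :: 'a::zero ^ 4) $ 2 = b"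
  "(vector [a, b, c, d] :: 'a::zero ^ 4) $ 3 = c"
  "(vector [a, b, c, d] :: 'a::zero ^ 4) $ 4 = d"
  unfolding vector_def by simp_all

definition cq_vec :: "cquat \<Rightarrow> real ^ 4" where
  "cq_vec q = vector [cq_t q, cq_x q, cq_y q, cq_z q]"

definition cq_of_vec :: "real ^ 4 \<Rightarrow> cquat" where
  "cq_of_vec v = CQuat (v $ 1) (v $ 2) (v $ 3) (v $ 4)"

lemma cq_of_vec_cq_vec: "cq_of_vec (cq_vec q) = q"
  by (simp add: cq_of_vec_def cq_vec_def)

lemma cq_vec_cq_of_vec: "cq_vec (cq_of_vec v) = v"
  by (simp add: cq_of_vec_def cq_vec_def vec_eq_iff forall_4)

definition hamilton_matrix :: "cquat \<Rightarrow> real ^ 4 ^ 4" where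
  "hamilton_matrix q = vector
     [vector [cq_t q, - cq_x q, cq_y q, - cq_z q],
      vector [cq_x q, cq_t q, cq_z q, cq_y q],
      vector [cq_y q, - cq_z q, cq_t q, - cq_x q],
      vector [cq_z q, cq_y q, cq_x q, cq_t q]]"

lemma hamilton_matrix_mult_vec: "hamilton_matrix q *v cq_vec p = cq_vec (q * p)"
  by (simp add: hamilton_matrix_def cq_vec_def times_cquat_def matrix_vector_mult_def
      vec_eq_iff forall_4 sum_4)

lemma hamilton_matrix_eq_matrix: "hamilton_matrix q = matrix (\<lambda>v. cq_vec (q * cq_of_vec v))"
proof -
  have "(\<lambda>v. cq_vec (q * cq_of_vec v)) = (*v) (hamilton_matrix q)"
    by (simp add: fun_eq_iff cq_vec_cq_of_vec flip: hamilton_matrix_mult_vec)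
  then show ?thesis by simp
qed

end

theory Submission
  imports Defs
begin

text \<open>
  The Hamilton matrix of \<open>q\<close> represents multiplication by \<open>q\<close> on the algebra. Since a matrix
  is determined by its action on column vectors, and every column vector is the coordinate
  vector of some quaternion, the algebraic claims are the ring axioms read through this
  representation: associativity makes it multiplicative, distributivity and compatibility with
  scalars make it linear, and the existence of a unit makes it injective (\<open>q\<close> is recovered as
  the image of \<open>1\<close>).

  The norm formula rests on the splitting of the algebra into two copies of the complex numbers.
  As \<open>j\<^sup>2 = 1\<close>, one may put \<open>j = 1\<close> (then \<open>k = i\<close>) or \<open>j = -1\<close> (then \<open>k = -i\<close>), which sends
  \<open>q = t + ix + jy + kz\<close> to \<open>u = (t + y) + i(x + z)\<close> and \<open>v = (t - y) + i(x - z)\<close>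
  respectively. The first conjugation is complex conjugation in both components, the second
  exchanges the components, and the third does both; so both components of the product of \<open>q\<close>
  with its conjugates equal \<open>\<bar>u\<bar>\<^sup>2 \<bar>v\<bar>\<^sup>2\<close>. The determinant of multiplication by \<open>q\<close> is the same
  number, because multiplication by a complex number \<open>u\<close> on the real plane has determinant
  \<open>\<bar>u\<bar>\<^sup>2\<close>. In coordinates this common value is the polynomial of \<open>cq_conj_prod\<close> and
  \<open>det_hamilton_matrix\<close>.
\<close>

lemma matrix_eqI_cq_vec:
  fixes A B :: "real ^ 4 ^ 4"
  assumes "\<And>p. A *v cq_vec p = B *v cq_vec p"
  shows "A = B"
  unfolding matrix_eq by (metis assms cq_vec_cq_of_vec)

lemma cq_vec_add: "cq_vec (p + q) = cq_vec p + cq_vec q"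
  by (simp add: cq_vec_def plus_cquat_def vec_eq_iff forall_4)

lemma cq_vec_scaleR: "cq_vec (r *\<^sub>R q) = r *\<^sub>R cq_vec q"
  by (simp add: cq_vec_def scaleR_cquat_def vec_eq_iff forall_4)

text \<open>Associativity: multiplying by \<open>p * q\<close> is multiplying by \<open>q\<close> and then by \<open>p\<close>.\<close>

lemma hamilton_matrix_mult:
  "hamilton_matrix (p * q) = hamilton_matrix p ** hamilton_matrix q"
  by (rule matrix_eqI_cq_vec)
    (simp add: hamilton_matrix_mult_vec mult.assoc flip: matrix_vector_mul_assoc)

lemma hamilton_matrix_add:
  "hamilton_matrix (p + q) = hamilton_matrix p + hamilton_matrix q"
  by (rule matrix_eqI_cq_vec)
    (simp add: hamilton_matrix_mult_vec matrix_vector_mult_add_rdistrib distrib_right cq_vec_add)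

lemma hamilton_matrix_scaleR:
  "hamilton_matrix (r *\<^sub>R q) = r *\<^sub>R hamilton_matrix q"
  by (rule matrix_eqI_cq_vec)
    (simp add: hamilton_matrix_mult_vec cq_vec_scaleR flip: scaleR_matrix_vector_assoc)

text \<open>Applying the matrix to the unit \<open>1\<close> gives back the quaternion.\<close>

lemma hamilton_matrix_inject:
  "hamilton_matrix p = hamilton_matrix q \<longleftrightarrow> p = q"
  by (metis cq_of_vec_cq_vec hamilton_matrix_mult_vec mult.right_neutral)

lemma trace_hamilton_matrix: "trace (hamilton_matrix q) = 4 * cq_t q"
  by (simp add: trace_def sum_4 hamilton_matrix_def)

text \<open>Each of \<open>i\<close>, \<open>j\<close>, \<open>k\<close> changes sign under exactly two of the three conjugations, so the
  imaginary parts cancel.\<close>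

lemma cq_conj_sum:
  "q + cq_conj1 q + cq_conj2 q + cq_conj3 q = of_real (4 * cq_t q)"
  by (simp add: of_real_cquat plus_cquat_def cq_conj1_def cq_conj2_def cq_conj3_def)

text \<open>The product \<open>\<bar>u\<bar>\<^sup>2 \<bar>v\<bar>\<^sup>2\<close> of the squared moduli of the two complex components.\<close>

lemma cq_conj_prod:
  "q * cq_conj1 q * cq_conj2 q * cq_conj3 q =
     of_real (((cq_t q + cq_y q)\<^sup>2 + (cq_x q + cq_z q)\<^sup>2) *
              ((cq_t q - cq_y q)\<^sup>2 + (cq_x q - cq_z q)\<^sup>2))"
  by (simp add: of_real_cquat times_cquat_def cq_conj1_def cq_conj2_def cq_conj3_def
      power2_eq_square algebra_simps)

lemma cq_norm_power4:
  "cq_norm q ^ 4 =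
     \<bar>((cq_t q + cq_y q)\<^sup>2 + (cq_x q + cq_z q)\<^sup>2) * ((cq_t q - cq_y q)\<^sup>2 + (cq_x q - cq_z q)\<^sup>2)\<bar>"
  using cq_norm_unique[OF cq_conj_prod] by blast

lemma det_4:
  fixes A :: "'a::comm_ring_1 ^ 4 ^ 4"
  shows "det A =
     A$1$1 * A$2$2 * A$3$3 * A$4$4
     - A$1$1 * A$2$2 * A$3$4 * A$4$3
     - A$1$1 * A$2$3 * A$3$2 * A$4$4
     + A$1$1 * A$2$3 * A$3$4 * A$4$2
     + A$1$1 * A$2$4 * A$3$2 * A$4$3
     - A$1$1 * A$2$4 * A$3$3 * A$4$2
     - A$1$2 * A$2$1 * A$3$3 * A$4$4
     + A$1$2 * A$2$1 * A$3$4 * A$4$3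
     + A$1$2 * A$2$3 * A$3$1 * A$4$4
     - A$1$2 * A$2$3 * A$3$4 * A$4$1
     - A$1$2 * A$2$4 * A$3$1 * A$4$3
     + A$1$2 * A$2$4 * A$3$3 * A$4$1
     + A$1$3 * A$2$1 * A$3$2 * A$4$4
     - A$1$3 * A$2$1 * A$3$4 * A$4$2
     - A$1$3 * A$2$2 * A$3$1 * A$4$4
     + A$1$3 * A$2$2 * A$3$4 * A$4$1
     + A$1$3 * A$2$4 * A$3$1 * A$4$2
     - A$1$3 * A$2$4 * A$3$2 * A$4$1
     - A$1$4 * A$2$1 * A$3$2 * A$4$3
     + A$1$4 * A$2$1 * A$3$3 * A$4$2
     + A$1$4 * A$2$2 * A$3$1 * A$4$3
     - A$1$4 * A$2$2 * A$3$3 * A$4$1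
     - A$1$4 * A$2$3 * A$3$1 * A$4$2
     + A$1$4 * A$2$3 * A$3$2 * A$4$1"
proof -
  have f1234: "finite {2::4, 3, 4}" "1 \<notin> {2::4, 3, 4}" by auto
  have f234: "finite {3::4, 4}" "2 \<notin> {3::4, 4}" by auto
  have f34: "finite {4::4}" "3 \<notin> {4::4}" by auto
  show ?thesis
    unfolding det_def UNIV_4
    unfolding sum_over_permutations_insert[OF f1234]
    unfolding sum_over_permutations_insert[OF f234]
    unfolding sum_over_permutations_insert[OF f34]
    unfolding permutes_sing
    by (simp add: sign_swap_id permutation_swap_id sign_compose sign_id swap_id_eq
        permutation_compose transpose_def algebra_simps)
qed

text \<open>Multiplication by \<open>q\<close> acts on the two complex components as multiplication by \<open>u\<close> and by
  \<open>v\<close>, with determinants \<open>\<bar>u\<bar>\<^sup>2\<close> and \<open>\<bar>v\<bar>\<^sup>2\<close>, which is why the quartic factors.\<close>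

lemma det_hamilton_matrix:
  "det (hamilton_matrix q) =
     ((cq_t q + cq_y q)\<^sup>2 + (cq_x q + cq_z q)\<^sup>2) * ((cq_t q - cq_y q)\<^sup>2 + (cq_x q - cq_z q)\<^sup>2)"
  by (simp add: det_4 hamilton_matrix_def power2_eq_square algebra_simps)

theorem theorem3p1:
  fixes q q1 :: cquat and t x y z r :: real
  assumes "q = CQuat t x y z"
  shows "hamilton_matrix (q * q1) = hamilton_matrix q ** hamilton_matrix q1 \<and>
    hamilton_matrix (cq_of_vec (hamilton_matrix q *v cq_vec q1)) =
      hamilton_matrix q ** hamilton_matrix q1 \<and>
    (q = q1 \<longleftrightarrow> hamilton_matrix q1 = hamilton_matrix q) \<and>
    hamilton_matrix (q + q1) = hamilton_matrix q + hamilton_matrix q1 \<and>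
    hamilton_matrix (r *\<^sub>R q) = r *\<^sub>R hamilton_matrix q \<and>
    (of_real (trace (hamilton_matrix q)) = q + cq_conj1 q + cq_conj2 q + cq_conj3 q \<and>
     q + cq_conj1 q + cq_conj2 q + cq_conj3 q = of_real (4 * t)) \<and>
    (cq_norm q ^ 4 = \<bar>det (hamilton_matrix q)\<bar> \<and>
     \<bar>det (hamilton_matrix q)\<bar> = \<bar>((t + y)\<^sup>2 + (x + z)\<^sup>2) * ((t - y)\<^sup>2 + (x - z)\<^sup>2)\<bar>)"
  using assms
  by (auto simp: hamilton_matrix_mult_vec cq_of_vec_cq_vec hamilton_matrix_mult
      hamilton_matrix_add hamilton_matrix_scaleR hamilton_matrix_inject
      trace_hamilton_matrix cq_conj_sum cq_norm_power4 det_hamilton_matrix)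

end
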